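(* Let $k\ge 1$ be an integer and let $S_k(x)=\sum_{n\ge 1}s_k(KG_{2,n})x^n$ be the generating function of the number of staircase $(KG_{2,n},k)$-words, where $KG_{2,n}$ is the king's graph of size $2\times n$. Put $$t_1=\frac{1-3x-2x^2-\sqrt{(1-3x-2x^2)^2-4x^2}}{2x}.$$ Then $$S_k(x)=\frac{x(t_1+2x)(3kt_1+2t_1x-3k-2t_1-2x-4)\,t_1^k}{(1-5x-2x^2)(t_1^{k+1}+2t_1^kx+2t_1x+1)(t_1-1)}+\frac{x(2t_1x+1)(3kt_1+2t_1x-3k+4t_1-2x+2)}{(1-5x-2x^2)(t_1^{k+1}+2t_1^kx+2t_1x+1)(t_1-1)}.$$
   Context: For a positive integer $k$ write $[k]=\{1,\dots,k\}$. For a graph $G$ with vertex set $V$, a $(G,k)$-word is a function $w\colon V\to[k]$; it is called staircase if $|w(u)-w(v)|\le 1$ for all adjacent $u,v\in V$. The number of staircase $(G,k)$-words is denoted $s_k(G)$. The king's graph $KG_{2,n}$ of size $2\times n$ has vertex set $\{(i,j): i\in\{1,2\},\ 1\le j\le n\}$, with $(i_1,j_1)$ and $(i_2,j_2)$ adjacent iff $|i_1-i_2|+|j_1-j_2|=1$ or $|i_1-i_2|=|j_1-j_2|=1$. The square root is the branch equal to $1$ at $x=0$, so $t_1$ is a power series in $x$ with zero constant term, and the identity is one of power series in $x$. *)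

theory Defs
  imports
    "HOL-Computational_Algebra.Formal_Power_Series"
    "HOL-Library.FuncSet"
    "Graph_Theory.Pair_Digraph"
begin

definition king_graph :: "nat \<Rightarrow> nat \<Rightarrow> (nat \<times> nat) pair_pre_digraph" where
  "king_graph m n =
     (let V = {1..m} \<times> {1..n};
          adj = (\<lambda>(i1, j1) (i2, j2).
            \<bar>int i1 - int i2\<bar> + \<bar>int j1 - int j2\<bar> = 1 \<or>
            (\<bar>int i1 - int i2\<bar> = 1 \<and> \<bar>int j1 - int j2\<bar> = 1))
      in \<lparr> pverts = V, parcs = {(u, v). u \<in> V \<and> v \<in> V \<and> adj u v} \<rparr>)"

(* The arcs form a symmetric irreflexive relation, so this is a finite simple undirected graph. *)
lemma pair_graph_king_graph: "pair_graph (king_graph m n)"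
proof -
  have *: "parcs (king_graph m n) \<subseteq> ({1..m} \<times> {1..n}) \<times> ({1..m} \<times> {1..n})"
    by (auto simp: king_graph_def Let_def)
  have "finite (parcs (king_graph m n))"
    by (rule finite_subset[OF *]) simp
  then show ?thesis
    by unfold_locales
      (auto simp: king_graph_def Let_def symmetric_def arcs_ends_def arc_to_ends_def
        with_proj_def image_def intro!: symI)
qed

definition words :: "'a pair_pre_digraph \<Rightarrow> nat \<Rightarrow> ('a \<Rightarrow> nat) set" where
  "words G k = pverts G \<rightarrow>\<^sub>E {1..k}"

definition staircase :: "'a pair_pre_digraph \<Rightarrow> ('a \<Rightarrow> nat) \<Rightarrow> bool" where
  "staircase G w \<longleftrightarrow> (\<forall>(u, v) \<in> parcs G. \<bar>int (w u) - int (w v)\<bar> \<le> 1)"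

definition num_staircase :: "nat \<Rightarrow> 'a pair_pre_digraph \<Rightarrow> nat" where
  "num_staircase k G = card {w \<in> words G k. staircase G w}"

definition staircase_gf :: "nat \<Rightarrow> real fps" where
  "staircase_gf k =
     Abs_fps (\<lambda>n. if n \<ge> 1 then of_nat (num_staircase k (king_graph 2 n)) else 0)"

definition disc :: "real fps" where
  "disc = (1 - 3 * fps_X - 2 * fps_X ^ 2) ^ 2 - 4 * fps_X ^ 2"

(* fps_radical root 2 is the square root whose constant term is root 2 of that of its argument,
   here root 2 1 = 1. The numerator below is divisible by 2 * fps_X, so the division is exact. *)
definition t1 :: "real fps" where
  "t1 = (1 - 3 * fps_X - 2 * fps_X ^ 2 - fps_radical root 2 disc) / (2 * fps_X)"

lemma sqrt_disc:
  "fps_radical root 2 disc ^ 2 = disc" "fps_nth (fps_radical root 2 disc) 0 = 1"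
proof -
  have d0: "fps_nth disc 0 = 1"
    unfolding disc_def by (simp add: fps_power_zeroth)
  then show "fps_nth (fps_radical root 2 disc) 0 = 1"
    by (simp add: d0)
  have "root (Suc 1) (fps_nth disc 0) ^ Suc 1 = fps_nth disc 0"
    by (simp add: d0)
  with d0 show "fps_radical root 2 disc ^ 2 = disc"
    using power_radical[of disc root 1] by (simp add: numeral_2_eq_2)
qed

lemma t1_exact:
  "2 * fps_X * t1 = 1 - 3 * fps_X - 2 * fps_X ^ 2 - fps_radical root 2 disc" (is "_ = ?N")
proof -
  have "fps_nth ?N 0 = 0"
    by (simp add: sqrt_disc(2) del: fps_radical_nth_0)
  then have "?N = fps_X * fps_shift 1 ?N"
    by (intro fps_ext) (simp del: fps_sub_nth add: fps_X_mult_nth)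
  also have "\<dots> = (2 * fps_const (1/2)) * (fps_X * fps_shift 1 ?N)"
    by (simp add: numeral_fps_const)
  finally have "?N = 2 * fps_X * (fps_const (1/2) * fps_shift 1 ?N)"
    by (simp only: mult_ac)
  then have "2 * fps_X dvd ?N"
    by (metis dvd_triv_left)
  then show ?thesis
    unfolding t1_def by simp
qed

(* The denominator of the closed form has nonzero constant term, so fps division inverts it. *)
lemma t1_nth_0: "fps_nth t1 0 = 0"
proof -
  let ?N = "1 - 3 * fps_X - 2 * fps_X ^ 2 - fps_radical root 2 disc"
  let ?P = "1 - 3 * fps_X - 2 * fps_X ^ 2 :: real fps"
  let ?R = "fps_radical root 2 disc"
  have "?N * (?N - 2 * ?P) = ?R ^ 2 - ?P ^ 2"
    by (simp add: power2_eq_square algebra_simps)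
  also have "\<dots> = (- 2 * fps_X) * (2 * fps_X)"
    unfolding sqrt_disc by (simp add: disc_def power2_eq_square algebra_simps)
  finally have "?N * (?N - 2 * ?P) = (- 2 * fps_X) * (2 * fps_X)" .
  then have "(2 * fps_X) * (t1 * (?N - 2 * (1 - 3 * fps_X - 2 * fps_X ^ 2))) = (2 * fps_X) * (- 2 * fps_X)"
    unfolding t1_exact[symmetric] by (simp add: mult_ac)
  then have "t1 * (?N - 2 * (1 - 3 * fps_X - 2 * fps_X ^ 2)) = - 2 * fps_X"
    by (subst (asm) mult_left_cancel) simp_all
  then have "fps_nth (t1 * (?N - 2 * (1 - 3 * fps_X - 2 * fps_X ^ 2))) 0 = fps_nth (- 2 * fps_X) 0"
    by simp
  then show ?thesis
    by (simp add: sqrt_disc(2) fps_power_zeroth del: fps_radical_nth_0)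
qed

lemma denom_nth_0:
  assumes "k \<ge> 1"
  shows "fps_nth ((1 - 5 * fps_X - 2 * fps_X ^ 2)
         * (t1 ^ (k + 1) + 2 * t1 ^ k * fps_X + 2 * t1 * fps_X + 1) * (t1 - 1)) 0 = -1"
  using assms by (simp add: t1_nth_0 fps_power_zeroth)

end

theory Submission
  imports Defs
begin

text \<open>A staircase word on the \<open>2 \<times> n\<close> king's graph is a walk of length \<open>n\<close> on the admissible
  columns \<open>(a, b)\<close>, \<open>\<bar>a - b\<bar> \<le> 1\<close>. Let \<open>F\<^sub>i\<close> and \<open>E\<^sub>i\<close> be the generating functions of the walks ending
  in \<open>(i, i)\<close> and in \<open>(i, i + 1)\<close> (or, by symmetry, in \<open>(i + 1, i)\<close>). Solving \<open>E\<^sub>i = x (1 + F\<^sub>i + F\<^sub>i\<^sub>+\<^sub>1 + 2 E\<^sub>i)\<close> for \<open>E\<^sub>i\<close> turns the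
  equations for \<open>F\<^sub>i\<close> into a linear recurrence in \<open>i\<close> with characteristic equation
  \<open>x t\<^sup>2 + x = (1 - 3 x - 2 x\<^sup>2) t\<close>, whose roots are \<open>t\<^sub>1\<close> and \<open>1 / t\<^sub>1\<close>, and with the constant
  particular solution \<open>c = x (1 + 2 x) / (1 - 5 x - 2 x\<^sup>2)\<close>. The reflection \<open>i \<mapsto> k + 1 - i\<close> forces
  \<open>F\<^sub>i = c + A (t\<^sub>1\<^sup>i + t\<^sub>1\<^sup>k\<^sup>+\<^sup>1\<^sup>-\<^sup>i)\<close>, and \<open>A\<close> is determined by the boundary condition
  \<open>F\<^sub>0 + 2 E\<^sub>0 = 0\<close>, which makes the equation for \<open>F\<^sub>i\<close> valid at \<open>i = 1\<close> too. Summing over all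
  columns gives the closed form.\<close>

section \<open>Words as walks on columns\<close>

text \<open>Consecutive columns of the king's graph are completely joined, so all four pairs of
  entries are constrained.\<close>

definition compat :: "nat \<times> nat \<Rightarrow> nat \<times> nat \<Rightarrow> bool" where
  "compat s s' \<longleftrightarrow>
     (\<forall>a\<in>{fst s, snd s}. \<forall>b\<in>{fst s', snd s'}. \<bar>int a - int b\<bar> \<le> 1)"

definition columns :: "nat \<Rightarrow> (nat \<times> nat) set" where
  "columns k = {s \<in> {1..k} \<times> {1..k}. \<bar>int (fst s) - int (snd s)\<bar> \<le> 1}"

definition col :: "(nat \<times> nat \<Rightarrow> nat) \<Rightarrow> nat \<Rightarrow> nat \<times> nat" where
  "col w j = (w (1, j), w (2, j))"

definition king_words :: "nat \<Rightarrow> nat \<Rightarrow> (nat \<times> nat \<Rightarrow> nat) set" where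
  "king_words k n = {w \<in> words (king_graph 2 n) k. staircase (king_graph 2 n) w}"

definition append_col ::
  "nat \<Rightarrow> nat \<times> nat \<Rightarrow> (nat \<times> nat \<Rightarrow> nat) \<Rightarrow> (nat \<times> nat \<Rightarrow> nat)" where
  "append_col n s w = w((1, Suc n) := fst s, (2, Suc n) := snd s)"

lemma finite_columns [simp]: "finite (columns k)"
  unfolding columns_def by (rule finite_subset[of _ "{1..k} \<times> {1..k}"]) auto

lemma finite_king_words: "finite (king_words k n)"
  unfolding king_words_def words_def king_graph_def Let_def
  by (rule finite_subset[of _ "({1..2} \<times> {1..n}) \<rightarrow>\<^sub>E {1..k}"]) (auto intro: finite_PiE)

lemma staircase_king_graph_iff:
  "staircase (king_graph 2 n) w \<longleftrightarrow>
     (\<forall>j\<in>{1..n}. \<bar>int (w (1, j)) - int (w (2, j))\<bar> \<le> 1) \<and>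
     (\<forall>j\<in>{1..<n}. compat (col w (Suc j)) (col w j))"
  (is "?L \<longleftrightarrow> ?R1 \<and> ?R2")
proof
  assume L: ?L
  have arc: "\<bar>int (w u) - int (w v)\<bar> \<le> 1" if "(u, v) \<in> parcs (king_graph 2 n)" for u v
    using L that unfolding staircase_def by auto
  show "?R1 \<and> ?R2"
    by (auto simp: compat_def col_def king_graph_def Let_def intro!: arc)
next
  assume R: "?R1 \<and> ?R2"
  have vert: "\<bar>int (w (1, j)) - int (w (2, j))\<bar> \<le> 1" if "j \<in> {1..n}" for j
    using R that by blast
  have step: "\<bar>int (w (i, Suc j)) - int (w (i', j))\<bar> \<le> 1"
    if "j \<in> {1..<n}" "i \<in> {1, 2}" "i' \<in> {1, 2}" for i i' j
    using R that unfolding compat_def col_def by auto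
  show ?L
    unfolding staircase_def
  proof clarify
    fix i j i' j'
    assume arc: "((i, j), (i', j')) \<in> parcs (king_graph 2 n)"
    then have ii: "i \<in> {1, 2}" "i' \<in> {1, 2}" and jj: "j \<in> {1..n}" "j' \<in> {1..n}"
      by (auto simp: king_graph_def Let_def)
    have "j = j' \<and> i \<noteq> i' \<or> j = Suc j' \<or> j' = Suc j"
      using arc by (auto simp: king_graph_def Let_def)
    then consider "j = j'" "i \<noteq> i'" | "j = Suc j'" | "j' = Suc j"
      by blast
    then show "\<bar>int (w (i, j)) - int (w (i', j'))\<bar> \<le> 1"
    proof cases
      case 1
      then show ?thesis
        using vert[of j] ii jj by (auto simp: abs_minus_commute)
    next
      case 2
      then show ?thesis
        using step[of j' i i'] ii jj by auto
    next
      case 3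
      then show ?thesis
        using step[of j i' i] ii jj by (auto simp: abs_minus_commute)
    qed
  qed
qed

lemma king_words_iff:
  "w \<in> king_words k n \<longleftrightarrow>
     w \<in> extensional ({1..2} \<times> {1..n}) \<and>
     (\<forall>j\<in>{1..n}. col w j \<in> columns k) \<and>
     (\<forall>j\<in>{1..<n}. compat (col w (Suc j)) (col w j))"
proof -
  have "w \<in> words (king_graph 2 n) k \<longleftrightarrow>
      w \<in> extensional ({1..2} \<times> {1..n}) \<and> (\<forall>i\<in>{1..2}. \<forall>j\<in>{1..n}. w (i, j) \<in> {1..k})"
    by (auto simp: words_def king_graph_def Let_def PiE_iff)
  moreover have "{1..2} = {1, 2::nat}"
    by auto
  ultimately show ?thesis
    by (auto simp: king_words_def staircase_king_graph_iff columns_def col_def)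
qed

lemma col_append_col:
  "col (append_col n s w) j = (if j = Suc n then s else col w j)"
  by (auto simp: col_def append_col_def)

text \<open>Deleting the last column undoes \<open>append_col\<close>. The guard
  \<open>n \<ge> 1\<close> leaves the first column free: at \<open>n = 0\<close> no column precedes
  it.\<close>

lemma king_words_Suc:
  assumes "s \<in> columns k"
  shows "{w \<in> king_words k (Suc n). col w (Suc n) = s} =
    append_col n s ` {w \<in> king_words k n. n \<ge> 1 \<longrightarrow> compat s (col w n)}"
    (is "?L = _ ` ?R")
proof (intro equalityI subsetI)
  fix w assume w: "w \<in> ?L"
  define v where "v = restrict w ({1..2} \<times> {1..n})"
  have col_v: "col v j = col w j" if "j \<in> {1..n}" for j
    using that by (auto simp: v_def col_def)
  have "v \<in> ?R"
    using w col_v by (auto simp: king_words_iff) (auto simp: v_def)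
  moreover have "w = append_col n s v"
  proof
    fix u :: "nat \<times> nat"
    obtain i j where u: "u = (i, j)"
      by fastforce
    have "u = (1, Suc n) \<or> u = (2, Suc n) \<or> u \<in> {1..2} \<times> {1..n} \<or>
        u \<notin> {1..2} \<times> {1..Suc n}"
      unfolding u by (cases "j = Suc n") auto
    then consider "u = (1, Suc n)" | "u = (2, Suc n)" | "u \<in> {1..2} \<times> {1..n}"
      | "u \<notin> {1..2} \<times> {1..Suc n}"
      by blast
    then show "w u = append_col n s v u"
    proof cases
      case 4
      then have "w u = undefined"
        using w extensional_arb[of w "{1..2} \<times> {1..Suc n}" u] by (simp add: king_words_iff)
      moreover have "u \<noteq> (1, Suc n)" "u \<noteq> (2, Suc n)" "u \<notin> {1..2} \<times> {1..n}"
        using 4 by auto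
      ultimately show ?thesis
        by (simp add: append_col_def v_def restrict_def)
    qed (use w in \<open>auto simp: append_col_def v_def col_def\<close>)
  qed
  ultimately show "w \<in> append_col n s ` ?R"
    by blast
next
  fix w assume "w \<in> append_col n s ` ?R"
  then obtain v where v: "v \<in> ?R" and w: "w = append_col n s v"
    by blast
  show "w \<in> ?L"
    using v assms
    by (auto simp: w king_words_iff col_append_col)
      (auto simp: append_col_def extensional_def less_Suc_eq)
qed

text \<open>Words are extensional, so both have the value \<open>undefined\<close> at the two
  overwritten positions and no information is lost.\<close>

lemma inj_on_append_col: "inj_on (append_col n s) (king_words k n)"
proof (rule inj_onI, rule ext)
  fix v w u
  assume v: "v \<in> king_words k n" and w: "w \<in> king_words k n"
    and eq: "append_col n s v = append_col n s w"
  show "v u = w u"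
  proof (cases "u \<in> {(1, Suc n), (2, Suc n)}")
    case True
    then show ?thesis
      using v w by (auto simp: king_words_iff extensional_def)
  next
    case False
    then show ?thesis
      using fun_cong[OF eq, of u] by (auto simp: append_col_def split: if_splits)
  qed
qed

lemma card_king_words_Suc:
  assumes "s \<in> columns k"
  shows "card {w \<in> king_words k (Suc n). col w (Suc n) = s} =
    card {w \<in> king_words k n. n \<ge> 1 \<longrightarrow> compat s (col w n)}"
  unfolding king_words_Suc[OF assms]
  by (intro card_image inj_on_subset[OF inj_on_append_col]) auto

lemma card_king_words_split:
  assumes "n \<ge> 1"
  shows "card {w \<in> king_words k n. P (col w n)} =
    (\<Sum>s\<in>{s \<in> columns k. P s}. card {w \<in> king_words k n. col w n = s})"
proof -
  have "{w \<in> king_words k n. P (col w n)} =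
    (\<Union>s\<in>{s \<in> columns k. P s}. {w \<in> king_words k n. col w n = s})"
    using assms by (auto simp: king_words_iff)
  then show ?thesis
    by (simp, subst card_UN_disjoint) (auto simp: finite_king_words)
qed

section \<open>Counting words through the transfer equations\<close>

lemma king_words_0: "king_words k 0 = {\<lambda>_. undefined}"
  by (auto simp: king_words_iff)

text \<open>The factor \<open>fps_X\<close> makes each coefficient of a solution depend only on the
  preceding ones, so every solution counts words by their last column and it suffices to exhibit
  one. The summand 1 accounts for words of a single column.\<close>

lemma transfer_system_unique:
  fixes P :: "nat \<times> nat \<Rightarrow> 'a::comm_semiring_1 fps"
  assumes P: "\<And>s. s \<in> columns k \<Longrightarrow>
    P s = fps_X * (1 + (\<Sum>s'\<in>{s' \<in> columns k. compat s s'}. P s'))"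
  assumes "s \<in> columns k"
  shows "fps_nth (P s) (Suc n) = of_nat (card {w \<in> king_words k (Suc n). col w (Suc n) = s})"
  using assms(2)
proof (induction n arbitrary: s)
  case 0
  have P0: "fps_nth (P s') 0 = 0" if "s' \<in> columns k" for s'
    by (subst P[OF that]) simp
  show ?case
    by (subst P[OF 0]) (simp add: card_king_words_Suc[OF 0] king_words_0 fps_sum_nth P0)
next
  case (Suc n)
  have "fps_nth (P s) (Suc (Suc n)) =
      (\<Sum>s'\<in>{s' \<in> columns k. compat s s'}. fps_nth (P s') (Suc n))"
    by (subst P[OF Suc.prems]) (simp add: fps_sum_nth)
  also have "\<dots> = (\<Sum>s'\<in>{s' \<in> columns k. compat s s'}.
      of_nat (card {w \<in> king_words k (Suc n). col w (Suc n) = s'}))"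
    by (intro sum.cong) (auto simp: Suc.IH)
  also have "\<dots> = of_nat (card {w \<in> king_words k (Suc (Suc n)). col w (Suc (Suc n)) = s})"
    unfolding card_king_words_Suc[OF Suc.prems]
    using card_king_words_split[of "Suc n" k "compat s"] by simp
  finally show ?case .
qed

lemma staircase_gf_eq_sum:
  fixes P :: "nat \<times> nat \<Rightarrow> real fps"
  assumes P: "\<And>s. s \<in> columns k \<Longrightarrow>
    P s = fps_X * (1 + (\<Sum>s'\<in>{s' \<in> columns k. compat s s'}. P s'))"
  shows "staircase_gf k = (\<Sum>s\<in>columns k. P s)"
proof (rule fps_ext)
  fix n
  show "fps_nth (staircase_gf k) n = fps_nth (\<Sum>s\<in>columns k. P s) n"
  proof (cases n)
    case 0
    have "fps_nth (P s) 0 = 0" if "s \<in> columns k" for s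
      by (subst P[OF that]) simp
    then show ?thesis
      by (simp add: 0 staircase_gf_def fps_sum_nth)
  next
    case (Suc m)
    have "num_staircase k (king_graph 2 n) = card {w \<in> king_words k n. True}"
      by (simp add: num_staircase_def king_words_def)
    also have "\<dots> = (\<Sum>s\<in>columns k. card {w \<in> king_words k n. col w n = s})"
      using card_king_words_split[of n k "\<lambda>_. True"] Suc by simp
    finally show ?thesis
      by (simp add: Suc staircase_gf_def fps_sum_nth transfer_system_unique[OF P])
  qed
qed

section \<open>Solving the transfer system\<close>

text \<open>Squaring \<open>t1_exact\<close> removes the radical, and a common factor
  \<open>4 * fps_X\<close> cancels.\<close>

lemma t1_quadratic: "fps_X * t1 ^ 2 + fps_X = (1 - 3 * fps_X - 2 * fps_X ^ 2) * t1"
proof -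
  define p where "p = (1 - 3 * fps_X - 2 * fps_X ^ 2 :: real fps)"
  have "(p - 2 * fps_X * t1) ^ 2 = p ^ 2 - 4 * fps_X ^ 2"
    using sqrt_disc(1) by (simp add: t1_exact p_def disc_def)
  then have "(4 * fps_X) * (fps_X * t1 ^ 2 + fps_X) = (4 * fps_X) * (p * t1)"
    by algebra
  then show ?thesis
    by (simp add: p_def)
qed

section \<open>Closed forms for the column series\<close>

definition particular :: "real fps" where
  "particular = fps_X * (1 + 2 * fps_X) / (1 - 5 * fps_X - 2 * fps_X ^ 2)"

text \<open>This is the coefficient of \<open>amplitude k\<close> in
  \<open>flat_gf k 0 + 2 * fps_X * (1 + flat_gf k 1)\<close>.\<close>

definition boundary_den :: "nat \<Rightarrow> real fps" where
  "boundary_den k = t1 ^ (k + 1) + 2 * t1 ^ k * fps_X + 2 * t1 * fps_X + 1"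

definition amplitude :: "nat \<Rightarrow> real fps" where
  "amplitude k = - (particular + 2 * fps_X + 2 * fps_X * particular) / boundary_den k"

text \<open>The exponent \<open>k + 1 - i\<close> stands in for \<open>-i\<close>: \<open>t1\<close>
  has zero constant term, hence no inverse power series.\<close>

definition flat_gf :: "nat \<Rightarrow> nat \<Rightarrow> real fps" where
  "flat_gf k i = particular + amplitude k * (t1 ^ i + t1 ^ (k + 1 - i))"

definition slope_gf :: "nat \<Rightarrow> nat \<Rightarrow> real fps" where
  "slope_gf k i = fps_X * (1 + flat_gf k i + flat_gf k (Suc i)) / (1 - 2 * fps_X)"

lemma fps_divide_times_cancel:
  fixes f g :: "'a::field fps"
  assumes "fps_nth g 0 \<noteq> 0"
  shows "f / g * g = f"
  using assms by (simp add: fps_divide_unit inverse_mult_eq_1 mult.assoc)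

lemma one_minus_2X_nonzero: "1 - 2 * fps_X \<noteq> (0 :: real fps)"
proof
  assume "1 - 2 * fps_X = (0 :: real fps)"
  from arg_cong[OF this, of "\<lambda>f. fps_nth f 0"] show False
    by simp
qed

lemma particular_eq:
  "particular * (1 - 5 * fps_X - 2 * fps_X ^ 2) = fps_X * (1 + 2 * fps_X)"
  unfolding particular_def by (rule fps_divide_times_cancel) (simp add: fps_power_zeroth)

lemma amplitude_eq:
  assumes "k \<ge> 1"
  shows "amplitude k * boundary_den k = - (particular + 2 * fps_X + 2 * fps_X * particular)"
  unfolding amplitude_def using assms
  by (intro fps_divide_times_cancel) (simp add: boundary_den_def fps_power_zeroth t1_nth_0)

lemma slope_gf_eq':
  "slope_gf k i * (1 - 2 * fps_X) = fps_X * (1 + flat_gf k i + flat_gf k (Suc i))"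
  unfolding slope_gf_def by (rule fps_divide_times_cancel) simp

lemma slope_gf_eq:
  "slope_gf k i = fps_X * (1 + flat_gf k i + flat_gf k (Suc i) + 2 * slope_gf k i)"
  using slope_gf_eq'[of k i] by algebra

lemma flat_gf_reflect: "i \<le> k + 1 \<Longrightarrow> flat_gf k (k + 1 - i) = flat_gf k i"
  by (simp add: flat_gf_def add.commute)

lemma slope_gf_reflect: "i \<le> k \<Longrightarrow> slope_gf k (k - i) = slope_gf k i"
  using flat_gf_reflect[of i k] flat_gf_reflect[of "Suc i" k]
  by (simp add: slope_gf_def Suc_diff_le algebra_simps)

text \<open>The columns \<open>(0, 0)\<close>, \<open>(0, 1)\<close> and \<open>(1, 0)\<close> lie
  outside the alphabet. Only the total of the formulas extended to them has to vanish, not each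
  one.\<close>

lemma boundary_left:
  assumes "k \<ge> 1"
  shows "flat_gf k 0 + 2 * slope_gf k 0 = 0"
proof -
  have "flat_gf k 0 = particular + amplitude k * (1 + t1 ^ (k + 1))"
    and "flat_gf k (Suc 0) = particular + amplitude k * (t1 + t1 ^ k)"
    by (simp_all add: flat_gf_def)
  \<comment> \<open>This is the claim times \<open>1 - 2 * fps_X\<close> with
    \<open>slope_gf k 0\<close> eliminated; the terms \<open>2 * fps_X * flat_gf k 0\<close>
    cancel.\<close>
  then have "flat_gf k 0 + 2 * fps_X * (1 + flat_gf k (Suc 0)) = 0"
    using amplitude_eq[OF assms] by (simp add: boundary_den_def algebra_simps)
  then have "(flat_gf k 0 + 2 * slope_gf k 0) * (1 - 2 * fps_X) = 0"
    using slope_gf_eq'[of k 0] by algebra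
  then show ?thesis
    using one_minus_2X_nonzero by simp
qed

lemma boundary_right:
  assumes "k \<ge> 1"
  shows "flat_gf k (Suc k) + 2 * slope_gf k k = 0"
  using boundary_left[OF assms] flat_gf_reflect[of 0 k] slope_gf_reflect[of 0 k] by simp

text \<open>After elimination of the slope series, the constant part satisfies the inhomogeneous
  equation. The quadratic for \<open>t1\<close> is palindromic, so ascending and descending powers
  both satisfy the homogeneous one.\<close>

lemma flat_gf_rec:
  assumes "i < k"
  shows "flat_gf k (Suc i) = fps_X * (1 + flat_gf k i + flat_gf k (Suc i) + flat_gf k (Suc (Suc i))
    + 2 * slope_gf k i + 2 * slope_gf k (Suc i))" (is "?L = ?R")
proof -
  \<comment> \<open>The descending exponents become \<open>m + 2\<close>, \<open>m + 1\<close> and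
    \<open>m\<close>, free of truncated subtraction.\<close>
  obtain m where k: "k = Suc (i + m)"
    using assms less_imp_Suc_add by auto
  define u v where "u = t1 ^ i" and "v = t1 ^ m"
  have "flat_gf k i = particular + amplitude k * (u + t1 ^ 2 * v)"
    "flat_gf k (Suc i) = particular + amplitude k * (t1 * u + t1 * v)"
    "flat_gf k (Suc (Suc i)) = particular + amplitude k * (t1 ^ 2 * u + v)"
    by (simp_all add: flat_gf_def k u_def v_def power2_eq_square mult.assoc)
  then have "?L * (1 - 2 * fps_X) = ?R * (1 - 2 * fps_X)"
    using slope_gf_eq'[of k i] slope_gf_eq'[of k "Suc i"] particular_eq t1_quadratic by algebra
  then show ?thesis
    using one_minus_2X_nonzero by simp
qed

section \<open>Verification of the transfer equations\<close>

definition column_gf :: "nat \<Rightarrow> nat \<times> nat \<Rightarrow> real fps" where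
  "column_gf k s = (if s \<notin> columns k then 0 else if fst s = snd s then flat_gf k (fst s)
     else slope_gf k (min (fst s) (snd s)))"

text \<open>Since \<open>column_gf\<close> is 0 outside \<open>columns k\<close>, neighbour sums may
  run over an explicit set that ignores the ends of the alphabet.\<close>

lemma sum_column_gf_mono_neutral:
  assumes "finite A" "{s' \<in> columns k. compat s s'} \<subseteq> A" "\<forall>s'\<in>A. compat s s'"
  shows "(\<Sum>s'\<in>{s' \<in> columns k. compat s s'}. column_gf k s') = (\<Sum>s'\<in>A. column_gf k s')"
  using assms by (intro sum.mono_neutral_left) (auto simp: column_gf_def)

lemma column_gf_flat_rec:
  assumes "i < k"
  shows "column_gf k (Suc i, Suc i) =
    fps_X * (1 + (\<Sum>s'\<in>{s' \<in> columns k. compat (Suc i, Suc i) s'}. column_gf k s'))"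
proof -
  \<comment> \<open>All pairs from three consecutive letters except the two whose entries differ by
    2.\<close>
  let ?A = "{(i, i), (Suc i, Suc i), (Suc (Suc i), Suc (Suc i)), (i, Suc i), (Suc i, i),
    (Suc i, Suc (Suc i)), (Suc (Suc i), Suc i)}"
  have sub: "{s' \<in> columns k. compat (Suc i, Suc i) s'} \<subseteq> ?A"
  proof
    fix s assume "s \<in> {s' \<in> columns k. compat (Suc i, Suc i) s'}"
    moreover obtain a b where "s = (a, b)"
      by fastforce
    ultimately have "a \<in> {i, Suc i, Suc (Suc i)}" "b \<in> {i, Suc i, Suc (Suc i)}"
      "\<bar>int a - int b\<bar> \<le> 1" and s: "s = (a, b)"
      by (auto simp: compat_def columns_def)
    then show "s \<in> ?A"
      by auto
  qed
  have "(\<Sum>s'\<in>{s' \<in> columns k. compat (Suc i, Suc i) s'}. column_gf k s') =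
      (\<Sum>s'\<in>?A. column_gf k s')"
    using sub by (intro sum_column_gf_mono_neutral) (auto simp: compat_def)
  also have "\<dots> = (column_gf k (i, i) + column_gf k (i, Suc i) + column_gf k (Suc i, i))
      + column_gf k (Suc i, Suc i)
      + (column_gf k (Suc (Suc i), Suc (Suc i)) + column_gf k (Suc i, Suc (Suc i))
         + column_gf k (Suc (Suc i), Suc i))"
    by simp
  \<comment> \<open>For \<open>i = 0\<close> all three columns are inadmissible: the left side is 0
    by definition, the right side by \<open>boundary_left\<close>.\<close>
  also have "column_gf k (i, i) + column_gf k (i, Suc i) + column_gf k (Suc i, i) =
      flat_gf k i + 2 * slope_gf k i"
    using assms boundary_left[of k] by (cases i) (auto simp: column_gf_def columns_def)
  \<comment> \<open>The same happens at the other end, when \<open>Suc i = k\<close>.\<close>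
  also have "column_gf k (Suc (Suc i), Suc (Suc i)) + column_gf k (Suc i, Suc (Suc i))
      + column_gf k (Suc (Suc i), Suc i) = flat_gf k (Suc (Suc i)) + 2 * slope_gf k (Suc i)"
    using assms boundary_right[of k]
    by (cases "Suc i = k") (auto simp: column_gf_def columns_def)
  finally show ?thesis
    using assms flat_gf_rec[OF assms] by (simp add: column_gf_def columns_def algebra_simps)
qed

text \<open>A letter within distance 1 of both \<open>i\<close> and \<open>Suc i\<close> is one of
  these two. All four resulting columns are admissible, so no boundary case arises.\<close>

lemma column_gf_slope_rec:
  assumes "1 \<le> i" "i < k" "s = (i, Suc i) \<or> s = (Suc i, i)"
  shows "column_gf k s =
    fps_X * (1 + (\<Sum>s'\<in>{s' \<in> columns k. compat s s'}. column_gf k s'))"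
proof -
  let ?A = "{(i, i), (Suc i, Suc i), (i, Suc i), (Suc i, i)}"
  have sub: "{s' \<in> columns k. compat s s'} \<subseteq> ?A"
  proof
    fix s' assume "s' \<in> {s' \<in> columns k. compat s s'}"
    moreover obtain a b where "s' = (a, b)"
      by fastforce
    ultimately have "a \<in> {i, Suc i}" "b \<in> {i, Suc i}" and "s' = (a, b)"
      using assms(3) by (auto simp: compat_def columns_def)
    then show "s' \<in> ?A"
      by auto
  qed
  have "(\<Sum>s'\<in>{s' \<in> columns k. compat s s'}. column_gf k s') = (\<Sum>s'\<in>?A. column_gf k s')"
    using sub assms(3) by (intro sum_column_gf_mono_neutral) (auto simp: compat_def)
  also have "\<dots> = flat_gf k i + flat_gf k (Suc i) + 2 * slope_gf k i"
    using assms(1,2) by (simp add: column_gf_def columns_def)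
  finally show ?thesis
    using assms slope_gf_eq[of k i] by (auto simp: column_gf_def columns_def algebra_simps)
qed

lemma columns_cases:
  assumes "s \<in> columns k"
  obtains (flat) i where "i < k" "s = (Suc i, Suc i)"
  | (slope) i where "1 \<le> i" "i < k" "s = (i, Suc i) \<or> s = (Suc i, i)"
proof -
  obtain a b where s: "s = (a, b)"
    by fastforce
  have ab: "a \<in> {1..k}" "b \<in> {1..k}" "\<bar>int a - int b\<bar> \<le> 1"
    using assms s by (auto simp: columns_def)
  then consider "a = b" | "b = Suc a" | "a = Suc b"
    by linarith
  then show thesis
  proof cases
    case 1
    then show thesis
      using ab s flat[of "a - 1"] by auto
  next
    case 2
    then show thesis
      using ab s slope[of a] by auto
  next
    case 3
    then show thesis
      using ab s slope[of b] by auto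
  qed
qed

lemma column_gf_rec:
  assumes "s \<in> columns k"
  shows "column_gf k s = fps_X * (1 + (\<Sum>s'\<in>{s' \<in> columns k. compat s s'}. column_gf k s'))"
  using assms by (cases rule: columns_cases) (auto simp: column_gf_flat_rec column_gf_slope_rec)

section \<open>Summation over all columns\<close>

lemma sum_column_gf:
  "(\<Sum>s\<in>columns k. column_gf k s) =
     (\<Sum>i\<in>{1..k}. flat_gf k i) + 2 * (\<Sum>i\<in>{1..<k}. slope_gf k i)"
proof -
  let ?D = "(\<lambda>i. (i, i)) ` {1..k}" and ?U = "(\<lambda>i. (i, Suc i)) ` {1..<k}"
    and ?L = "(\<lambda>i. (Suc i, i)) ` {1..<k}"
  have cols: "columns k = ?D \<union> (?U \<union> ?L)"
  proof (intro equalityI subsetI)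
    fix s assume "s \<in> columns k"
    then show "s \<in> ?D \<union> (?U \<union> ?L)"
      by (cases rule: columns_cases) auto
  qed (auto simp: columns_def)
  have "(\<Sum>s\<in>columns k. column_gf k s) =
      (\<Sum>s\<in>?D. column_gf k s) + ((\<Sum>s\<in>?U. column_gf k s) + (\<Sum>s\<in>?L. column_gf k s))"
    unfolding cols by (subst sum.union_disjoint; (subst sum.union_disjoint)?) auto
  also have "(\<Sum>s\<in>?D. column_gf k s) = (\<Sum>i\<in>{1..k}. flat_gf k i)"
    by (subst sum.reindex) (auto simp: inj_on_def column_gf_def columns_def intro!: sum.cong)
  also have "(\<Sum>s\<in>?U. column_gf k s) = (\<Sum>i\<in>{1..<k}. slope_gf k i)"
    by (subst sum.reindex) (auto simp: inj_on_def column_gf_def columns_def intro!: sum.cong)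
  also have "(\<Sum>s\<in>?L. column_gf k s) = (\<Sum>i\<in>{1..<k}. slope_gf k i)"
    by (subst sum.reindex) (auto simp: inj_on_def column_gf_def columns_def intro!: sum.cong)
  finally show ?thesis
    by simp
qed

text \<open>The reflection of the index makes the two power sums equal, and the factor
  \<open>1 - t1\<close> telescopes the geometric sum.\<close>

lemma sum_flat_gf:
  "(\<Sum>i\<in>{1..k}. flat_gf k i) * (1 - t1) =
     of_nat k * particular * (1 - t1) + 2 * amplitude k * (t1 - t1 ^ (k + 1))"
proof -
  have refl: "(\<Sum>i\<in>{1..k}. t1 ^ (k + 1 - i)) = (\<Sum>i\<in>{1..k}. t1 ^ i)"
    by (rule sum.reindex_bij_witness[of _ "\<lambda>i. k + 1 - i" "\<lambda>i. k + 1 - i"]) auto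
  have geo: "(\<Sum>i\<in>{1..k}. t1 ^ i) * (1 - t1) = t1 - t1 ^ (k + 1)"
  proof (induction k)
    case (Suc k)
    have "(\<Sum>i\<in>{1..Suc k}. t1 ^ i) * (1 - t1) =
        (\<Sum>i\<in>{1..k}. t1 ^ i) * (1 - t1) + t1 ^ Suc k * (1 - t1)"
      by (simp add: distrib_right)
    also have "\<dots> = t1 - t1 ^ (Suc k + 1)"
      unfolding Suc.IH by (simp add: algebra_simps)
    finally show ?case .
  qed simp
  have "(\<Sum>i\<in>{1..k}. flat_gf k i) =
      of_nat k * particular + 2 * amplitude k * (\<Sum>i\<in>{1..k}. t1 ^ i)"
    by (simp only: flat_gf_def sum.distrib sum_distrib_left[symmetric] refl) simp
  then show ?thesis
    unfolding geo[symmetric] by (simp only: distrib_right mult.assoc)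
qed

text \<open>Each shifted sum of flat series is the full sum without one end term, and the two end
  terms agree by reflection.\<close>

lemma sum_slope_gf:
  assumes "k \<ge> 1"
  shows "(\<Sum>i\<in>{1..<k}. slope_gf k i) * (1 - 2 * fps_X) =
    fps_X * (of_nat k - 1 + 2 * (\<Sum>i\<in>{1..k}. flat_gf k i) - 2 * flat_gf k 1)"
proof -
  obtain m where k: "k = Suc m"
    using assms by (cases k) auto
  have lower: "(\<Sum>i\<in>{1..<k}. flat_gf k i) = (\<Sum>i\<in>{1..k}. flat_gf k i) - flat_gf k k"
    by (simp add: k atLeastLessThanSuc_atLeastAtMost)
  have "(\<Sum>i\<in>{1..k}. flat_gf k i) = flat_gf k 1 + (\<Sum>i\<in>{Suc 1..k}. flat_gf k i)"
    using assms by (intro sum.atLeast_Suc_atMost) auto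
  also have "(\<Sum>i\<in>{Suc 1..k}. flat_gf k i) = (\<Sum>i\<in>{1..<k}. flat_gf k (Suc i))"
    by (simp only: k atLeastLessThanSuc_atLeastAtMost sum.atLeast_Suc_atMost_Suc_shift o_def)
  finally have upper:
    "(\<Sum>i\<in>{1..<k}. flat_gf k (Suc i)) = (\<Sum>i\<in>{1..k}. flat_gf k i) - flat_gf k 1"
    by simp
  have refl: "flat_gf k k = flat_gf k 1"
    using flat_gf_reflect[of 1 k] by simp
  have "(\<Sum>i\<in>{1..<k}. slope_gf k i) * (1 - 2 * fps_X) =
      fps_X * ((\<Sum>i\<in>{1..<k}. 1) + (\<Sum>i\<in>{1..<k}. flat_gf k i) + (\<Sum>i\<in>{1..<k}. flat_gf k (Suc i)))"
    by (simp only: sum_distrib_right slope_gf_eq' sum_distrib_left[symmetric] sum.distrib)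
  then show ?thesis
    unfolding lower upper refl by (simp add: k algebra_simps)
qed

theorem theorem8:
  fixes k :: nat
  assumes "k \<ge> 1"
  shows "staircase_gf k =
      (fps_X * (t1 + 2 * fps_X)
         * (3 * of_nat k * t1 + 2 * t1 * fps_X - 3 * of_nat k - 2 * t1 - 2 * fps_X - 4) * t1 ^ k)
      / ((1 - 5 * fps_X - 2 * fps_X ^ 2)
         * (t1 ^ (k + 1) + 2 * t1 ^ k * fps_X + 2 * t1 * fps_X + 1) * (t1 - 1))
    + (fps_X * (2 * t1 * fps_X + 1)
         * (3 * of_nat k * t1 + 2 * t1 * fps_X - 3 * of_nat k + 4 * t1 - 2 * fps_X + 2))
      / ((1 - 5 * fps_X - 2 * fps_X ^ 2)
         * (t1 ^ (k + 1) + 2 * t1 ^ k * fps_X + 2 * t1 * fps_X + 1) * (t1 - 1))"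
    (is "_ = ?N1 / ?D + ?N2 / ?D")
proof -
  \<comment> \<open>Opaque names, in particular \<open>T\<close> for the power with symbolic
    exponent, turn what follows into polynomial algebra.\<close>
  define F where "F = (\<Sum>i\<in>{1..k}. flat_gf k i)"
  define E where "E = (\<Sum>i\<in>{1..<k}. slope_gf k i)"
  define p :: "real fps" where "p = 1 - 5 * fps_X - 2 * fps_X ^ 2"
  define c where "c = particular"
  define A where "A = amplitude k"
  define Q where "Q = boundary_den k"
  define T where "T = t1 ^ k"
  define t where "t = t1"
  define x :: "real fps" where "x = fps_X"
  define K :: "real fps" where "K = of_nat k"
  have S: "staircase_gf k = F + 2 * E"
    unfolding F_def E_def
    using staircase_gf_eq_sum[OF column_gf_rec] sum_column_gf by simp
  have cp: "c * p = x * (1 + 2 * x)"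
    using particular_eq by (simp add: c_def p_def x_def)
  have AQ: "A * Q = - (c + 2 * x + 2 * x * c)"
    using amplitude_eq[OF assms] by (simp add: A_def Q_def c_def x_def)
  have F: "F * (1 - t) = K * c * (1 - t) + 2 * A * (t - t * T)"
    using sum_flat_gf[of k] by (simp add: F_def K_def c_def t_def A_def T_def)
  have E: "E * (1 - 2 * x) = x * (K - 1 + 2 * F - 2 * (c + A * (t + T)))"
    using sum_slope_gf[OF assms]
    by (simp add: E_def F_def K_def x_def c_def A_def t_def T_def flat_gf_def)
  have p: "p = 1 - 5 * x - 2 * x ^ 2"
    by (simp add: p_def x_def)
  have Q: "Q = t * T + 2 * T * x + 2 * t * x + 1"
    by (simp add: Q_def boundary_den_def t_def T_def x_def)
  have FE: "(F + 2 * E) * (1 - 2 * x) = F * (1 + 2 * x) + 2 * x * (K - 1 - 2 * (c + A * (t + T)))"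
    using E by algebra
  \<comment> \<open>The factor \<open>p\<close> clears the denominator of \<open>c\<close>, and
    \<open>p * Q\<close> that of \<open>A\<close>.\<close>
  have Fpq: "F * (p * Q * (t - 1)) = K * (x * (1 + 2 * x)) * Q * (t - 1)
      + 2 * (x * (1 + 2 * x) + 2 * x * p + 2 * x * (x * (1 + 2 * x))) * (t - t * T)"
    using F cp AQ by algebra
  have Apq: "(c + A * (t + T)) * (p * Q * (t - 1)) = x * (1 + 2 * x) * Q * (t - 1)
      - (x * (1 + 2 * x) + 2 * x * p + 2 * x * (x * (1 + 2 * x))) * (t + T) * (t - 1)"
    using cp AQ by algebra
  have "((F + 2 * E) * (p * Q * (t - 1))) * (1 - 2 * x) =
      F * (p * Q * (t - 1)) * (1 + 2 * x) + 2 * x * (K - 1) * (p * Q * (t - 1))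
      - 4 * x * ((c + A * (t + T)) * (p * Q * (t - 1)))"
    using FE by algebra
  also have "\<dots> = (x * (t + 2 * x) * (3 * K * t + 2 * t * x - 3 * K - 2 * t - 2 * x - 4) * T
      + x * (2 * t * x + 1) * (3 * K * t + 2 * t * x - 3 * K + 4 * t - 2 * x + 2)) * (1 - 2 * x)"
    \<comment> \<open>What remains is a polynomial identity in \<open>x\<close>, \<open>t\<close>,
      \<open>T\<close> and \<open>K\<close>; the quadratic equation of \<open>t1\<close> has done
      its work in \<open>flat_gf_rec\<close>.\<close>
    unfolding Fpq Apq unfolding p Q by algebra
  finally have "((F + 2 * E) * ?D) * (1 - 2 * fps_X) = (?N1 + ?N2) * (1 - 2 * fps_X)"
    by (simp only: p_def Q_def boundary_den_def t_def T_def x_def K_def)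
  then have prod: "(F + 2 * E) * ?D = ?N1 + ?N2"
    using one_minus_2X_nonzero by (simp only: mult_right_cancel not_False_eq_True)
  \<comment> \<open>The constant term of the denominator is -1, so both quotients are exact.\<close>
  have D0: "fps_nth ?D 0 \<noteq> 0"
    using denom_nth_0[OF assms] by simp
  then have "?D \<noteq> 0"
    by (metis fps_zero_nth)
  moreover have "(?N1 / ?D + ?N2 / ?D) * ?D = ?N1 + ?N2"
    using fps_divide_times_cancel[OF D0, of ?N1] fps_divide_times_cancel[OF D0, of ?N2]
    by (simp only: distrib_right[of "?N1 / ?D" "?N2 / ?D" ?D])
  ultimately show ?thesis
    using prod S by (metis mult_right_cancel)
qed

end
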